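(* Let $\mathcal{M}=(Q,\Sigma,\cdot,\circ)$ be a bireversible Mealy automaton such that $\langle\mathcal{M}\rangle$ is infinite and has at least one element of infinite order. Then the following are equivalent: (i) $\mathrm{Stab}_{\langle\mathcal{M}\rangle}(\xi)$ is a torsion group for every $\xi\in\Sigma^\omega$; (ii) $\mathcal{P}(\mathfrak{d}\mathcal{M})=\varnothing$, and for every nonempty $u\in Q^*$ one has $\mathrm{Stab}^{+}_{\langle\mathfrak{d}\mathcal{M}\rangle}(u^\omega)\neq\{1\}$ if and only if $\pi(u^\ell)=1$ for some $\ell\geq 1$; (iii) for every nonempty $v\in Q^*$, the orbital graph $\Gamma(\langle\mathfrak{d}\mathcal{M}\rangle,\Sigma,Q^\omega,v^\omega)$ is either finite or an acyclic multidigraph.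
   Context: A Mealy automaton is $\mathcal{M}=(Q,\Sigma,\cdot,\circ)$ with finite nonempty sets $Q$ (states) and $\Sigma$ (alphabet), a transition function $(q,a)\mapsto q\cdot a\in Q$ and a production function $(q,a)\mapsto q\circ a\in\Sigma$; write $q\xrightarrow{a|b}p$ when $q\cdot a=p$, $q\circ a=b$. Extend by $q\circ(a_1\cdots a_n)=(q\circ a_1)\big((q\cdot a_1)\circ(a_2\cdots a_n)\big)$. It is invertible if each map $a\mapsto q\circ a$ is a permutation of $\Sigma$, reversible if each map $q\mapsto q\cdot a$ is a permutation of $Q$, and bireversible if it is invertible, reversible and, for each $b\in\Sigma$, the map sending $q$ to the target of its unique transition with output letter $b$ is a permutation of $Q$. For an invertible automaton each $q$ acts as an automorphism of the rooted tree $\Sigma^*$; $\langle\mathcal{M}\rangle$ is the group generated by these automorphisms (identity $1$), acting on $\Sigma^\omega$. The dual automaton $\mathfrak{d}\mathcal{M}$ has stateset $\Sigma$, alphabet $Q$, and a transition $a\xrightarrow{q|p}b$ whenever $q\xrightarrow{a|b}p$ is a transition of $\mathcal{M}$. If $\mathcal{M}$ is reversible then $\mathfrak{d}\mathcal{M}$ is invertible, and $\langle\mathfrak{d}\mathcal{M}\rangle$ is generated by $\Sigma$ and acts on $Q^*$ and $Q^\omega$ (reading words of $Q$ from left to right). For an invertible automaton with group $G$: $\mathrm{Stab}_G(\xi)$ is the stabilizer in $G$ of the boundary point $\xi$; $\mathrm{Stab}^+_G(\xi)$ is the set of elements of $\mathrm{Stab}_G(\xi)$ that are products of (possibly zero)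 states, without inverses. $\mathcal{P}(\mathfrak{d}\mathcal{M})$ is the set of nonempty words in $\Sigma^*$ (no inverses) that represent the identity of $\langle\mathfrak{d}\mathcal{M}\rangle$. For $u=q_1\cdots q_k\in Q^*$, $\pi(u)\in\langle\mathcal{M}\rangle$ is the product of the states of $u$, where $q_1$ is applied first, then $q_2$, and so on (the order compatible with the dual automaton reading $u$ from left to right). $u^\omega=uuu\cdots$. The orbital graph $\Gamma(\langle\mathfrak{d}\mathcal{M}\rangle,\Sigma,Q^\omega,v^\omega)$ is the connected component of $v^\omega$ in the directed multigraph with vertex set $Q^\omega$ and an edge labeled $a$ from $\eta$ to $\eta'$ whenever $a\in\Sigma$ maps $\eta$ to $\eta'$ (only generators in $\Sigma$, not their inverses). An acyclic multidigraph is a multidigraph without directed cycles. *)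

theory Defs
  imports
    "HOL-Library.Omega_Words_Fun"
    "HOL-Algebra.Bij"
    "HOL-Algebra.Generated_Groups"
    "HOL-Algebra.Group_Action"
    "Graph_Theory.Digraph_Component"
begin

text \<open>
  The state set and the alphabet of a Mealy automaton are rendered as types; finiteness is imposed
  by the type class \<open>finite\<close> where the automaton is introduced, and types are nonempty.
  The fields \<open>next_state M q a\<close> and \<open>out_letter M q a\<close> are $q \cdot a$ and $q \circ a$.
\<close>

record ('q, 'a) mealy =
  next_state :: "'q \<Rightarrow> 'a \<Rightarrow> 'q"
  out_letter :: "'q \<Rightarrow> 'a \<Rightarrow> 'a"

definition mealy_invertible :: "('q, 'a) mealy \<Rightarrow> bool" where
  "mealy_invertible M \<longleftrightarrow> (\<forall>q. bij (\<lambda>a. out_letter M q a))"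

definition mealy_reversible :: "('q, 'a) mealy \<Rightarrow> bool" where
  "mealy_reversible M \<longleftrightarrow> (\<forall>a. bij (\<lambda>q. next_state M q a))"

text \<open>
  If \<open>M\<close> is invertible, \<open>inv_into UNIV (out_letter M q) b\<close> is the input letter of the unique
  transition that leaves \<open>q\<close> with output letter \<open>b\<close>.
\<close>

definition mealy_bireversible :: "('q, 'a) mealy \<Rightarrow> bool" where
  "mealy_bireversible M \<longleftrightarrow> mealy_invertible M \<and> mealy_reversible M \<and>
     (\<forall>b. bij (\<lambda>q. next_state M q (inv_into UNIV (out_letter M q) b)))"

definition dual_mealy :: "('q, 'a) mealy \<Rightarrow> ('a, 'q) mealy" where
  "dual_mealy M = \<lparr>next_state = (\<lambda>a q. out_letter M q a), out_letter = (\<lambda>a q. next_state M q a)\<rparr>"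

fun state_act :: "('q, 'a) mealy \<Rightarrow> 'q \<Rightarrow> 'a list \<Rightarrow> 'a list" where
  "state_act M q [] = []"
| "state_act M q (a # w) = out_letter M q a # state_act M (next_state M q a) w"

text \<open>
  The group generated by the states, as a subgroup of the group of all bijections of the vertex set
  of the rooted tree of words over \<open>'a\<close>. It is meaningful when \<open>M\<close> is invertible: only then are the
  generators bijections.
\<close>

definition mealy_group :: "('q, 'a) mealy \<Rightarrow> ('a list \<Rightarrow> 'a list) monoid" where
  "mealy_group M = (BijGroup UNIV)\<lparr>carrier := generate (BijGroup UNIV) (range (state_act M))\<rparr>"

text \<open>
  The product of the states of a word, the first letter being applied first. As multiplication in
  \<open>BijGroup\<close> is composition \<open>g \<circ> f\<close>, this is the product of the letters from right to left
  in that group.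
\<close>

definition state_prod :: "('q, 'a) mealy \<Rightarrow> 'q list \<Rightarrow> 'a list \<Rightarrow> 'a list" where
  "state_prod M u = fold (state_act M) u"

text \<open>
  The action of a tree automorphism on the boundary: the letter at position \<open>n\<close> of the image
  is read off from the image of the prefix of length \<open>Suc n\<close>.
\<close>

definition boundary_act :: "('a list \<Rightarrow> 'a list) \<Rightarrow> 'a word \<Rightarrow> 'a word" where
  "boundary_act g \<xi> = (\<lambda>n. g (prefix (Suc n) \<xi>) ! n)"

definition Stab :: "('q, 'a) mealy \<Rightarrow> 'a word \<Rightarrow> ('a list \<Rightarrow> 'a list) set" where
  "Stab M \<xi> = stabilizer (mealy_group M) boundary_act \<xi>"

definition Stab_pos :: "('q, 'a) mealy \<Rightarrow> 'a word \<Rightarrow> ('a list \<Rightarrow> 'a list) set" where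
  "Stab_pos M \<xi> = {g \<in> Stab M \<xi>. \<exists>u. g = state_prod M u}"

definition positive_relations :: "('q, 'a) mealy \<Rightarrow> 'q list set" where
  "positive_relations M = {u. u \<noteq> [] \<and> state_prod M u = \<one>\<^bsub>mealy_group M\<^esub>}"

definition torsion_group :: "('g, 'm) monoid_scheme \<Rightarrow> bool" where
  "torsion_group G \<longleftrightarrow> group G \<and> (\<forall>g \<in> carrier G. \<exists>n::nat. n \<ge> 1 \<and> g [^]\<^bsub>G\<^esub> n = \<one>\<^bsub>G\<^esub>)"

text \<open>
  The arc \<open>(\<eta>, s)\<close> is the edge labelled \<open>s\<close> that starts at \<open>\<eta>\<close>; only the states themselves, not
  their inverses, give edges.
\<close>

definition boundary_graph :: "('q, 'a) mealy \<Rightarrow> ('a word, 'a word \<times> 'q) pre_digraph" where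
  "boundary_graph M = \<lparr>verts = UNIV, arcs = UNIV, tail = fst,
     head = (\<lambda>(\<eta>, s). boundary_act (state_act M s) \<eta>)\<rparr>"

text \<open>The connected component ignores edge directions.\<close>

definition orbital_graph ::
    "('q, 'a) mealy \<Rightarrow> 'a word \<Rightarrow> ('a word, 'a word \<times> 'q) pre_digraph" where
  "orbital_graph M \<xi> = boundary_graph M \<restriction> {\<eta>. \<xi> \<rightarrow>\<^sup>*\<^bsub>mk_symmetric (boundary_graph M)\<^esub> \<eta>}"

definition acyclic_multidigraph :: "('v, 'e) pre_digraph \<Rightarrow> bool" where
  "acyclic_multidigraph G \<longleftrightarrow> (\<nexists>p. pre_digraph.cycle G p)"

end

theory Submission
  imports Defs "HOL-Algebra.Multiplicative_Group"
begin

text \<open>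
  Write \<open>D\<close> for the dual of \<open>M\<close>. Call a word \<open>u\<close> of states and a word \<open>w\<close> of letters a
  commuting pair if \<open>u\<close> maps \<open>w\<close> to \<open>w\<close> and, dually, \<open>w\<close> maps \<open>u\<close> to \<open>u\<close>; such a pair is a
  rectangle that tiles the plane periodically. All three statements turn out to be equivalent to one
  condition, \<open>commuting_torsion M\<close>: for every commuting pair of nonempty words,
  the product of \<open>u\<close> has finite order.

  The bridge between boundary points and commuting pairs is finiteness. An invertible automaton
  permutes the words of each length, so if \<open>w\<close> fixes the boundary point \<open>u\<^sup>\<omega>\<close>, then some power of
  \<open>u\<close> commutes with \<open>w\<close>; conversely each member of a commuting pair fixes the periodic point
  spanned by the other (\<open>fixes_iter_commuting\<close>, \<open>commuting_fixes_iter\<close>). Moreover, a positive word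
  that fixes an arbitrary point has, by the pigeonhole principle on its sections along that point, a
  section that belongs to a commuting pair, and in a reversible automaton finite order passes from
  a section at a fixed word back to the word itself (\<open>fixing_word_finite_order\<close>).

  The delicate point is the torsion of stabilizers in the whole group, whose elements are products
  of states \<^emph>\<open>and inverses\<close>. Here the tiling picture helps. In a tiling of the plane by
  transitions that is constant along one diagonal direction, each diagonal determines the next one;
  as there are only finitely many tiles, such a tiling is periodic in both directions. A square in it
  whose side is a period has a commuting pair as its boundary, and every state occurs in a
  pair of this kind (\<open>commuting_pair_through_state\<close>). Hence under
  \<open>commuting_torsion M\<close> every state occurs in a positive word of finite order, so its inverse
  is a positive word, and the group consists of positive words (\<open>mealy_group_positive\<close>).

  The element of infinite order is what excludes positive relations in the dual: if
  a nonempty \<open>w\<close> acted trivially on all words of states, every \<open>u\<close> would have a power that commutes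
  with \<open>w\<close>, so \<open>commuting_torsion M\<close> would make the whole group torsion.

  For the orbital graphs, bireversibility ensures that the component of \<open>v\<^sup>\<omega>\<close> contains periodic
  points only, even though it is built with inverses of letters. A directed cycle at the point
  \<open>y\<^sup>\<omega>\<close> is a nonempty word fixing it, thus gives a commuting pair, and the component of \<open>v\<^sup>\<omega>\<close>
  is finite if and only if \<open>v\<close> has finite order: if the orbit is finite, its points have a common
  period, so for a suitable power \<open>x\<close> of \<open>v\<close> the sections of powers of \<open>x\<close> are powers of the
  sections of \<open>x\<close>, and an exponent of the symmetric group on the alphabet is an exponent for \<open>x\<close>.
\<close>

section \<open>Cross diagrams\<close>

abbreviation word_power :: "nat \<Rightarrow> 'x list \<Rightarrow> 'x list" where
  "word_power n u \<equiv> concat (replicate n u)"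

lemma next_state_dual [simp]: "next_state (dual_mealy M) a q = out_letter M q a"
  and out_letter_dual [simp]: "out_letter (dual_mealy M) a q = next_state M q a"
  by (simp_all add: dual_mealy_def)

lemma dual_dual [simp]: "dual_mealy (dual_mealy M) = M"
  by (simp add: dual_mealy_def)

lemma length_state_act [simp]: "length (state_act M q w) = length w"
  by (induction w arbitrary: q) simp_all

lemma state_prod_Nil [simp]: "state_prod M [] = id"
  by (simp add: state_prod_def id_def)

lemma state_prod_Cons: "state_prod M (q # u) w = state_prod M u (state_act M q w)"
  by (simp add: state_prod_def)

lemma state_prod_append: "state_prod M (u @ v) w = state_prod M v (state_prod M u w)"
  by (simp add: state_prod_def)

lemma length_state_prod [simp]: "length (state_prod M u w) = length w"
  by (induction u arbitrary: w) (simp_all add: state_prod_Cons)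

lemma state_prod_Nil_word [simp]: "state_prod M u [] = []"
  using length_state_prod[of M u "[]"] by (metis length_0_conv)

lemma state_prod_Cons_word:
  "state_prod M u (a # w) = state_prod M u [a] @ state_prod M (state_act (dual_mealy M) a u) w"
proof (induction u arbitrary: a w)
  case (Cons q u)
  show ?case
    using Cons.IH[of "out_letter M q a" "state_act M (next_state M q a) w"]
    by (simp add: state_prod_Cons)
qed simp

text \<open>
  Stacking the transitions of \<open>u\<close> on \<open>w\<close> gives a rectangle with left side \<open>u\<close> and bottom \<open>w\<close>; its top
  is the image of \<open>w\<close>, and its right side, the section of \<open>u\<close> at \<open>w\<close>, is the image of \<open>u\<close> under \<open>w\<close>
  in the dual. Since the dual of the dual is \<open>M\<close>, this law governs concatenation on both sides.
\<close>

lemma state_prod_append_word: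
  "state_prod M u (w @ w') = state_prod M u w @ state_prod M (state_prod (dual_mealy M) w u) w'"
proof (induction w arbitrary: u)
  case (Cons a w)
  have "state_prod M u (a # w @ w')
      = state_prod M u [a] @ state_prod M (state_act (dual_mealy M) a u) (w @ w')"
    by (rule state_prod_Cons_word)
  also have "\<dots> = (state_prod M u [a] @ state_prod M (state_act (dual_mealy M) a u) w) @
      state_prod M (state_prod (dual_mealy M) (a # w) u) w'"
    by (simp add: Cons.IH state_prod_Cons)
  also have "\<dots> = state_prod M u (a # w) @ state_prod M (state_prod (dual_mealy M) (a # w) u) w'"
    using state_prod_Cons_word[of M u a w] by simp
  finally show ?case by simp
qed simp

lemma state_prod_word_power: "state_prod M (word_power n u) = state_prod M u ^^ n"
  by (induction n) (simp_all add: fun_eq_iff state_prod_append funpow_swap1)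

lemma length_word_power [simp]: "length (word_power n w) = n * length w"
  by (induction n) simp_all

lemma word_power_eq_Nil_iff [simp]: "word_power n w = [] \<longleftrightarrow> n = 0 \<or> w = []"
  using length_word_power[of n w] by (metis length_0_conv mult_is_0)

section \<open>Inverse automaton and bireversibility\<close>

text \<open>
  Exchanging input and output letters inverts each state. With this automaton at hand, the third
  condition of bireversibility is reversibility of the inverse.
\<close>

definition inverse_mealy :: "('q, 'a) mealy \<Rightarrow> ('q, 'a) mealy" where
  "inverse_mealy M = \<lparr>next_state = (\<lambda>q b. next_state M q (inv_into UNIV (out_letter M q) b)),
     out_letter = (\<lambda>q b. inv_into UNIV (out_letter M q) b)\<rparr>"

lemma mealy_bireversible_iff:
  "mealy_bireversible M \<longleftrightarrow>
     mealy_invertible M \<and> mealy_reversible M \<and> mealy_reversible (inverse_mealy M)"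
  by (simp add: mealy_bireversible_def mealy_reversible_def inverse_mealy_def)

lemma mealy_invertible_dual [simp]: "mealy_invertible (dual_mealy M) \<longleftrightarrow> mealy_reversible M"
  by (simp add: mealy_invertible_def mealy_reversible_def)

lemma mealy_reversible_dual [simp]: "mealy_reversible (dual_mealy M) \<longleftrightarrow> mealy_invertible M"
  by (simp add: mealy_invertible_def mealy_reversible_def)

lemma inverse_mealy_out:
  assumes "mealy_invertible M"
  shows "out_letter (inverse_mealy M) q (out_letter M q a) = a"
    and "out_letter M q (out_letter (inverse_mealy M) q b) = b"
    and "next_state (inverse_mealy M) q b = next_state M q (out_letter (inverse_mealy M) q b)"
  using assms unfolding mealy_invertible_def inverse_mealy_def
  by (simp_all add: bij_is_inj bij_is_surj surj_f_inv_f)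

lemma state_act_inverse_mealy:
  assumes "mealy_invertible M"
  shows "state_act (inverse_mealy M) q (state_act M q w) = w"
    and "state_act M q (state_act (inverse_mealy M) q w) = w"
  by (induction w arbitrary: q) (simp_all add: inverse_mealy_out[OF assms])

lemma bij_state_act: "mealy_invertible M \<Longrightarrow> bij (state_act M q)"
  by (rule o_bij[of "state_act (inverse_mealy M) q"])
     (simp_all add: fun_eq_iff state_act_inverse_mealy)

lemma bij_state_prod: "mealy_invertible M \<Longrightarrow> bij (state_prod M u)"
proof (induction u)
  case (Cons q u)
  have "state_prod M (q # u) = state_prod M u \<circ> state_act M q"
    by (simp add: fun_eq_iff state_prod_Cons)
  with Cons show ?case by (metis bij_comp bij_state_act)
qed simp

lemma next_state_injD:
  assumes "mealy_reversible M" "next_state M q a = next_state M q' a"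
  shows "q = q'"
  using assms unfolding mealy_reversible_def by (meson bij_is_inj injD)

text \<open>
  Regard a transition as a square tile with its source on the left, its target on the right, its
  input at the bottom and its output on top. Then the right and top edges determine the tile.
\<close>

lemma transition_map_inj:
  assumes "mealy_bireversible M"
    and "next_state M q a = next_state M q' a'" "out_letter M q a = out_letter M q' a'"
  shows "q = q' \<and> a = a'"
proof -
  from assms(1) have inv: "mealy_invertible M" and rev: "mealy_reversible (inverse_mealy M)"
    by (simp_all add: mealy_bireversible_iff)
  have "next_state (inverse_mealy M) q (out_letter M q a)
      = next_state (inverse_mealy M) q' (out_letter M q a)"
    using assms(2,3) inverse_mealy_out[OF inv] by metis
  with rev have "q = q'" by (rule next_state_injD)
  moreover from this assms(3) have "a = a'" using inverse_mealy_out(1)[OF inv] by metis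
  ultimately show ?thesis by simp
qed

text \<open>
  Bireversibility is determinism of the tile set at all four corners, a condition invariant under
  reflection in the diagonal. Finiteness turns injectivity into bijectivity.
\<close>

lemma mealy_bireversible_dual:
  fixes M :: "('q::finite, 'a::finite) mealy"
  assumes "mealy_bireversible M"
  shows "mealy_bireversible (dual_mealy M)"
proof -
  let ?D = "dual_mealy M"
  from assms have inv: "mealy_invertible ?D" by (simp add: mealy_bireversible_iff)
  have "inj (\<lambda>a. next_state (inverse_mealy ?D) a p)" for p
  proof (rule injI)
    fix a b assume eq: "next_state (inverse_mealy ?D) a p = next_state (inverse_mealy ?D) b p"
    note * = inverse_mealy_out[OF inv]
    from eq have "out_letter M (out_letter (inverse_mealy ?D) a p) a
        = out_letter M (out_letter (inverse_mealy ?D) b p) b"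
      by (simp add: *(3))
    moreover have "next_state M (out_letter (inverse_mealy ?D) a p) a
        = next_state M (out_letter (inverse_mealy ?D) b p) b"
      using *(2) by simp
    ultimately show "a = b" using transition_map_inj[OF assms] by metis
  qed
  then have "mealy_reversible (inverse_mealy ?D)"
    by (simp add: mealy_reversible_def bij_def finite_UNIV_inj_surj)
  with assms show ?thesis by (simp add: mealy_bireversible_iff)
qed

section \<open>Finite order and sections\<close>

definition finite_order :: "('x \<Rightarrow> 'x) \<Rightarrow> bool" where
  "finite_order f \<longleftrightarrow> (\<exists>l\<ge>1. f ^^ l = id)"

lemma finite_order_funpow_iff:
  assumes "n \<ge> 1"
  shows "finite_order (f ^^ n) \<longleftrightarrow> finite_order f"
proof
  assume "finite_order (f ^^ n)"
  then obtain l where "l \<ge> 1" "f ^^ (n * l) = id"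
    by (auto simp: finite_order_def funpow_mult)
  with assms show "finite_order f"
    unfolding finite_order_def by (intro exI[of _ "n * l"]) simp
next
  assume "finite_order f"
  then obtain l where "l \<ge> 1" "f ^^ l = id" by (auto simp: finite_order_def)
  then have "(f ^^ n) ^^ l = id"
    using funpow_mult[of n l f] funpow_mult[of l n f] by (simp add: mult.commute)
  with \<open>l \<ge> 1\<close> show "finite_order (f ^^ n)" by (auto simp: finite_order_def)
qed

lemma state_prod_recurrent:
  fixes w :: "'a::finite list"
  assumes "mealy_invertible M"
  obtains l where "l \<ge> 1" "(state_prod M u ^^ l) w = w"
proof -
  have "length ((state_prod M u ^^ n) w) = length w" for n
    by (induction n) simp_all
  then have "{y. \<exists>n. y = (state_prod M u ^^ n) w} \<subseteq> {y. set y \<subseteq> UNIV \<and> length y = length w}"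
    by auto
  then have "finite {y. \<exists>n. y = (state_prod M u ^^ n) w}"
    by (rule finite_subset) (rule finite_lists_length_eq, simp)
  with bij_state_prod[OF assms, THEN bij_is_inj] show ?thesis
    by (rule funpow_inj_finite) (use that in \<open>auto simp: Suc_le_eq\<close>)
qed

lemma section_of_trivial_word:
  assumes "state_prod M u = id"
  shows "state_prod M (state_prod (dual_mealy M) w u) = id"
proof
  fix w'
  have "w @ w' = w @ state_prod M (state_prod (dual_mealy M) w u) w'"
    using state_prod_append_word[of M u w w'] assms by simp
  then show "state_prod M (state_prod (dual_mealy M) w u) w' = id w'" by simp
qed

text \<open>
  Some power of \<open>w\<close> returns \<open>u\<close> to itself because the dual permutes words of each length, so
  \<open>u\<close> is in turn a section of its own section.
\<close>

lemma trivial_word_of_trivial_section: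
  fixes M :: "('q::finite, 'a) mealy"
  assumes "mealy_reversible M" "state_prod M (state_prod (dual_mealy M) w u) = id"
  shows "state_prod M u = id"
proof -
  obtain l where l: "l \<ge> 1" "(state_prod (dual_mealy M) w ^^ l) u = u"
    using state_prod_recurrent[of "dual_mealy M"] assms(1) by auto
  have "u = state_prod (dual_mealy M) (word_power (l - 1) w) (state_prod (dual_mealy M) w u)"
    using l by (cases l) (simp_all add: state_prod_word_power funpow_swap1)
  with section_of_trivial_word[OF assms(2)] show ?thesis by metis
qed


section \<open>Action on the boundary\<close>

lemma state_prod_take: "state_prod M u (take n w) = take n (state_prod M u w)"
proof (cases "n \<le> length w")
  case True
  then show ?thesis
    using state_prod_append_word[of M u "take n w" "drop n w"] by simp
qed simp

text \<open>The maps for which \<^const>\<open>boundary_act\<close> is a genuine extension to infinite words.\<close>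

definition tree_map :: "('x list \<Rightarrow> 'x list) \<Rightarrow> bool" where
  "tree_map g \<longleftrightarrow> (\<forall>w. length (g w) = length w) \<and> (\<forall>n w. g (take n w) = take n (g w))"

lemma tree_map_state_prod [simp]: "tree_map (state_prod M u)"
  by (simp add: tree_map_def state_prod_take)

lemma tree_map_comp: "tree_map g \<Longrightarrow> tree_map f \<Longrightarrow> tree_map (g \<circ> f)"
  by (simp add: tree_map_def)

lemma tree_map_inv:
  assumes "tree_map g" "bij g"
  shows "tree_map (inv_into UNIV g)"
proof -
  have g: "g (inv_into UNIV g w) = w" for w using assms(2) by (simp add: bij_is_surj surj_f_inv_f)
  have len: "length (inv_into UNIV g w) = length w" for w
    using assms(1) g unfolding tree_map_def by metis
  have "inv_into UNIV g (take n w) = take n (inv_into UNIV g w)" for n w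
  proof -
    have "g (take n (inv_into UNIV g w)) = take n w" using assms(1) g by (simp add: tree_map_def)
    then show ?thesis using assms(2) by (metis bij_is_inj inv_f_f)
  qed
  with len show ?thesis by (simp add: tree_map_def)
qed

lemma prefix_eqI:
  assumes "\<And>n. prefix n \<xi> = prefix n \<eta>"
  shows "\<xi> = \<eta>"
proof
  fix n
  show "\<xi> n = \<eta> n"
    using arg_cong[OF assms[of "Suc n"], of "\<lambda>x. x ! n"] by (simp del: subseq_to_Suc)
qed

lemma prefix_boundary_act:
  assumes "tree_map g"
  shows "prefix n (boundary_act g \<xi>) = g (prefix n \<xi>)"
proof (rule nth_equalityI)
  fix i assume "i < length (prefix n (boundary_act g \<xi>))"
  then have "i < n" by simp
  then have "g (prefix (Suc i) \<xi>) = take (Suc i) (g (prefix n \<xi>))"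
    using assms unfolding tree_map_def
    by (metis Suc_leI min.absorb1 add_0 subsequence_take)
  with \<open>i < n\<close> show "prefix n (boundary_act g \<xi>) ! i = g (prefix n \<xi>) ! i"
    by (simp add: boundary_act_def del: subseq_to_Suc)
qed (use assms in \<open>simp add: tree_map_def\<close>)

lemma boundary_act_comp:
  assumes "tree_map g" "tree_map f"
  shows "boundary_act (g \<circ> f) \<xi> = boundary_act g (boundary_act f \<xi>)"
  by (rule prefix_eqI) (simp add: assms prefix_boundary_act tree_map_comp)

lemma boundary_act_id [simp]: "boundary_act id \<xi> = \<xi>"
  by (rule prefix_eqI) (simp add: prefix_boundary_act tree_map_def)

lemma boundary_act_fixed_iff:
  assumes "tree_map g"
  shows "boundary_act g \<xi> = \<xi> \<longleftrightarrow> (\<forall>n. g (prefix n \<xi>) = prefix n \<xi>)"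
  using prefix_boundary_act[OF assms] prefix_eqI by metis

lemma boundary_act_inj:
  assumes "tree_map g" "inj g" "boundary_act g \<xi> = boundary_act g \<eta>"
  shows "\<xi> = \<eta>"
  by (rule prefix_eqI) (metis assms prefix_boundary_act injD)

lemma boundary_act_conc:
  "boundary_act (state_prod M u) (w \<frown> \<xi>) =
     state_prod M u w \<frown> boundary_act (state_prod M (state_prod (dual_mealy M) w u)) \<xi>"
proof
  fix n
  show "boundary_act (state_prod M u) (w \<frown> \<xi>) n =
      (state_prod M u w \<frown> boundary_act (state_prod M (state_prod (dual_mealy M) w u)) \<xi>) n"
  proof (cases "n < length w")
    case True
    then show ?thesis by (simp add: boundary_act_def state_prod_take del: subseq_to_Suc)
  next
    case False
    then show ?thesis
      by (simp add: boundary_act_def state_prod_append_word nth_append Suc_diff_le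
          del: subseq_to_Suc)
  qed
qed

text \<open>
  Periodic words are the solutions of a fixed-point equation; this replaces position
  arithmetic modulo the period in what follows.
\<close>

lemma iter_eqI:
  assumes "x \<noteq> []" "\<eta> = x \<frown> \<eta>"
  shows "\<eta> = x\<^sup>\<omega>"
proof
  fix n
  show "\<eta> n = x\<^sup>\<omega> n"
  proof (induction n rule: less_induct)
    case (less n)
    have "\<eta> n = (x \<frown> \<eta>) n" using assms(2) by simp
    moreover have "n - length x < n" if "\<not> n < length x"
      using that assms(1) by (simp add: diff_less length_greater_0_conv[symmetric] del: length_greater_0_conv)
    ultimately show ?case using less.IH[of "n - length x"] assms(1)
      by (cases "n < length x") (simp_all add: le_mod_geq)
  qed
qed

lemma iter_unroll_power: "x \<noteq> [] \<Longrightarrow> word_power n x \<frown> x\<^sup>\<omega> = x\<^sup>\<omega>"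
proof (induction n)
  case (Suc n)
  have "word_power (Suc n) x \<frown> x\<^sup>\<omega> = x \<frown> (word_power n x \<frown> x\<^sup>\<omega>)"
    by (simp del: conc_conc add: conc_conc[symmetric])
  with Suc show ?case by (metis iter_unroll length_greater_0_conv)
qed simp

lemma iter_word_power: "x \<noteq> [] \<Longrightarrow> n \<ge> 1 \<Longrightarrow> (word_power n x)\<^sup>\<omega> = x\<^sup>\<omega>"
  by (rule iter_eqI[symmetric]) (simp_all add: iter_unroll_power)

section \<open>Commuting pairs\<close>

definition commuting :: "('q, 'a) mealy \<Rightarrow> 'q list \<Rightarrow> 'a list \<Rightarrow> bool" where
  "commuting M u w \<longleftrightarrow> state_prod M u w = w \<and> state_prod (dual_mealy M) w u = u"

lemma commuting_dual: "commuting (dual_mealy M) w u \<longleftrightarrow> commuting M u w"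
  by (auto simp: commuting_def)

lemma boundary_act_iter:
  assumes "state_prod (dual_mealy M) w u = u" "w \<noteq> []"
  shows "boundary_act (state_prod M u) (w\<^sup>\<omega>) = (state_prod M u w)\<^sup>\<omega>"
proof (rule iter_eqI)
  show "state_prod M u w \<noteq> []" using assms(2) by (metis length_0_conv length_state_prod)
  have "w \<frown> w\<^sup>\<omega> = w\<^sup>\<omega>" using assms(2) iter_unroll[of w] by simp
  then show "boundary_act (state_prod M u) (w\<^sup>\<omega>)
      = state_prod M u w \<frown> boundary_act (state_prod M u) (w\<^sup>\<omega>)"
    using boundary_act_conc[of M u w "w\<^sup>\<omega>"] assms(1) by simp
qed

lemma commuting_fixes_iter:
  "commuting M u w \<Longrightarrow> w \<noteq> [] \<Longrightarrow> boundary_act (state_prod M u) (w\<^sup>\<omega>) = w\<^sup>\<omega>"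
  by (simp add: commuting_def boundary_act_iter)

text \<open>
  Turns equations between periodic boundary points back into equations between finite words; equal
  lengths are what makes the prefixes match.
\<close>

lemma boundary_act_iter_power:
  assumes "boundary_act (state_prod M u) (w\<^sup>\<omega>) = x\<^sup>\<omega>" "length w = length x" "x \<noteq> []"
  shows "state_prod M u (word_power n w) = word_power n x"
proof -
  have "w \<noteq> []" using assms by auto
  with assms have "boundary_act (state_prod M u) (word_power n w \<frown> w\<^sup>\<omega>) = word_power n x \<frown> x\<^sup>\<omega>"
    by (simp add: iter_unroll_power)
  with assms(2) show ?thesis unfolding boundary_act_conc by simp
qed

text \<open>
  Every power of \<open>w\<close> is fixed by \<open>u\<close>; the powers of \<open>w\<close> permute the words as long as \<open>u\<close>, so
  one of them fixes \<open>u\<close>.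
\<close>

lemma fixes_iter_commuting:
  fixes M :: "('q::finite, 'a) mealy"
  assumes "mealy_reversible M" "boundary_act (state_prod M u) (w\<^sup>\<omega>) = w\<^sup>\<omega>" "w \<noteq> []"
  obtains l where "l \<ge> 1" "commuting M u (word_power l w)"
proof -
  obtain l where "l \<ge> 1" "(state_prod (dual_mealy M) w ^^ l) u = u"
    using state_prod_recurrent[of "dual_mealy M"] assms(1) by auto
  with boundary_act_iter_power[OF assms(2) refl assms(3)] that show ?thesis
    by (auto simp: commuting_def state_prod_word_power)
qed

text \<open>
  View transitions as square tiles, as above. In an invertible automaton the left and top
  edges determine the tile, and its right and bottom edges can again be used as the left and top edges
  of the next tile. Reversibility makes this procedure a permutation \<open>\<Psi>\<close> of the
  finite set of edge pairs, so iterating it from \<open>q\<close> returns to the start after \<open>m\<close> steps. Putting the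
  \<open>d\<close>-th tile at all positions \<open>(x, y)\<close> with \<open>x - y = d\<close> gives a tiling of the plane of period
  \<open>m\<close> in both directions, and the boundary of an \<open>m \<times> m\<close> square in it is a commuting pair.
\<close>

lemma commuting_pair_through_state:
  fixes M :: "('q::finite, 'a::finite) mealy"
  assumes "mealy_invertible M" "mealy_reversible M"
  obtains u w where "q \<in> set u" "w \<noteq> []" "commuting M u w"
proof -
  let ?N = "inverse_mealy M"
  define \<Psi> where "\<Psi> = (\<lambda>(q, b). (next_state ?N q b, out_letter ?N q b))"
  note N = inverse_mealy_out[OF assms(1)]
  have "inj \<Psi>"
  proof (rule injI, clarify)
    fix q b q' b' assume "\<Psi> (q, b) = \<Psi> (q', b')"
    then have out: "out_letter ?N q b = out_letter ?N q' b'"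
      and "next_state M q (out_letter ?N q b) = next_state M q' (out_letter ?N q' b')"
      by (auto simp: \<Psi>_def N(3))
    then have "q = q'" by (metis next_state_injD[OF assms(2)])
    moreover have "b = out_letter M q (out_letter ?N q b)" by (simp only: N(2))
    moreover have "b' = out_letter M q' (out_letter ?N q' b')" by (simp only: N(2))
    ultimately show "q = q' \<and> b = b'" using out by (simp only:)
  qed
  then obtain m where m: "m > 0" "(\<Psi> ^^ m) (q, undefined) = (q, undefined)"
    by (rule funpow_inj_finite[of _ "(q, undefined)"]) (simp, blast)
  define s where "s = (\<lambda>d. fst ((\<Psi> ^^ d) (q, undefined)))"
  define a where "a = (\<lambda>d. snd ((\<Psi> ^^ d) (q, undefined)))"
  have step: "next_state M (s d) (a (Suc d)) = s (Suc d)" "out_letter M (s d) (a (Suc d)) = a d" for d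
    by (simp_all add: s_def a_def \<Psi>_def N split: prod.split)
  \<comment> \<open>The index \<open>x - y\<close> decreases upwards, and the state at the bottom of a column is applied first;
    hence the reversal.\<close>
  define row where "row = (\<lambda>d n. map a [d..<d + n])"
  define col where "col = (\<lambda>d k. map s (rev [d..<d + k]))"
  have row_Suc: "row d (Suc n) = a d # row (Suc d) n" for d n
    by (simp add: row_def upt_conv_Cons del: upt_Suc)
  have col_Suc: "col d (Suc k) = s (d + k) # col d k" for d k
    by (simp add: col_def)
  have act_row: "state_act M (s d) (row (Suc d) n) = row d n" for d n
    by (induction n arbitrary: d) (simp_all add: row_Suc step, simp add: row_def)
  have act_col: "state_act (dual_mealy M) (a (d + k)) (col d k) = col (Suc d) k" for d k
    by (induction k) (simp_all add: col_Suc step, simp add: col_def)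
  have rows: "state_prod M (col d k) (row (d + k) n) = row d n" for d k n
    by (induction k) (simp_all add: col_Suc state_prod_Cons act_row, simp add: col_def)
  have cols: "state_prod (dual_mealy M) (row (d + k) n) (col d k) = col (d + n) k" for d k n
  proof (induction n arbitrary: d)
    case (Suc n)
    from Suc[of "Suc d"] show ?case by (simp add: row_Suc state_prod_Cons act_col)
  qed (simp add: row_def)
  have period: "s (d + m) = s d" "a (d + m) = a d" for d
    by (simp_all add: s_def a_def funpow_add m)
  have "row m m = row 0 m" "col m m = col 0 m"
    using period by (simp_all add: row_def col_def map_add_upt[symmetric] rev_map o_def)
  with rows[of 0 m m] cols[of 0 m m] have "commuting M (col 0 m) (row 0 m)"
    by (simp add: commuting_def)
  moreover have "q \<in> set (col 0 m)" using m(1) by (force simp: col_def s_def image_iff)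
  moreover have "row 0 m \<noteq> []" using m(1) by (simp add: row_def)
  ultimately show ?thesis using that by blast
qed

text \<open>The condition to which all three statements of the theorem reduce.\<close>

definition commuting_torsion :: "('q, 'a) mealy \<Rightarrow> bool" where
  "commuting_torsion M \<longleftrightarrow>
     (\<forall>u w. u \<noteq> [] \<longrightarrow> w \<noteq> [] \<longrightarrow> commuting M u w \<longrightarrow> finite_order (state_prod M u))"

text \<open>
  The sections of \<open>u\<close> at the prefixes of \<open>\<xi>\<close> are words of one length, so two of them agree. The
  common section \<open>h\<close> commutes with the part \<open>w\<close> of \<open>\<xi>\<close> between the two prefixes. As \<open>u\<close> fixes
  the first prefix, powers of \<open>h\<close> are sections of powers of \<open>u\<close>, and triviality passes back
  from a section.
\<close>

lemma fixing_word_finite_order: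
  fixes M :: "('q::finite, 'a::finite) mealy"
  assumes "mealy_reversible M" "commuting_torsion M"
    and "boundary_act (state_prod M u) \<xi> = \<xi>"
  shows "finite_order (state_prod M u)"
proof (cases "u = []")
  case True
  then show ?thesis by (auto simp: finite_order_def intro: exI[of _ 1])
next
  case False
  let ?D = "dual_mealy M"
  have fixed: "state_prod M u (prefix n \<xi>) = prefix n \<xi>" for n
    using assms(3) by (simp add: boundary_act_fixed_iff)
  have "range (\<lambda>n. state_prod ?D (prefix n \<xi>) u) \<subseteq> {y. set y \<subseteq> UNIV \<and> length y = length u}"
    by auto
  then have "finite (range (\<lambda>n. state_prod ?D (prefix n \<xi>) u))"
    by (rule finite_subset) (rule finite_lists_length_eq, simp)
  then have "\<not> inj (\<lambda>n. state_prod ?D (prefix n \<xi>) u)"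
    using finite_imageD[of _ "UNIV :: nat set"] by auto
  then obtain i j where "i < j"
    and eq: "state_prod ?D (prefix i \<xi>) u = state_prod ?D (prefix j \<xi>) u"
    unfolding inj_def by (metis linorder_neqE_nat)
  define p where "p = prefix i \<xi>"
  define w where "w = \<xi> [i \<rightarrow> j]"
  define h where "h = state_prod ?D p u"
  have pw: "prefix j \<xi> = p @ w"
    using \<open>i < j\<close> subsequence_append[of \<xi> i "j - i"] by (simp add: p_def w_def)
  have "w \<noteq> []" using \<open>i < j\<close> by (simp add: w_def)
  have fix_p: "state_prod M u p = p" using fixed by (simp add: p_def)
  have "state_prod M h w = w"
    using fixed[of j] fix_p unfolding pw state_prod_append_word h_def by simp
  moreover have "state_prod ?D w h = h"
    using eq unfolding pw h_def by (simp add: state_prod_append p_def)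
  moreover have "h \<noteq> []" using False unfolding h_def by (metis length_0_conv length_state_prod)
  ultimately have "finite_order (state_prod M h)"
    using assms(2) \<open>w \<noteq> []\<close> by (auto simp: commuting_torsion_def commuting_def)
  then obtain l where l: "l \<ge> 1" "state_prod M (word_power l h) = id"
    by (auto simp: finite_order_def state_prod_word_power)
  have "state_prod ?D p (word_power l u) = word_power l h"
  proof (induction l)
    case (Suc l)
    then show ?case
      using state_prod_append_word[of ?D p u] fix_p by (simp add: h_def)
  qed simp
  with l have "state_prod M (state_prod ?D p (word_power l u)) = id" by simp
  then have "state_prod M (word_power l u) = id" by (rule trivial_word_of_trivial_section[OF assms(1)])
  with l show ?thesis by (auto simp: finite_order_def state_prod_word_power)
qed


section \<open>The group of an automaton\<close>

lemma carrier_BijGroup_UNIV: "carrier (BijGroup UNIV) = {f. bij f}"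
  by (auto simp: BijGroup_def Bij_def extensional_def)

lemma mult_BijGroup_UNIV: "bij g \<Longrightarrow> bij f \<Longrightarrow> g \<otimes>\<^bsub>BijGroup UNIV\<^esub> f = g \<circ> f"
  by (auto simp: BijGroup_def Bij_def extensional_def compose_def fun_eq_iff)

lemma one_BijGroup_UNIV: "\<one>\<^bsub>BijGroup UNIV\<^esub> = id"
  by (simp add: BijGroup_def fun_eq_iff)

lemma inv_BijGroup_UNIV: "bij f \<Longrightarrow> inv\<^bsub>BijGroup UNIV\<^esub> f = inv_into UNIV f"
  by (subst inv_BijGroup) (auto simp: Bij_def extensional_def fun_eq_iff)

lemma pow_BijGroup_UNIV:
  assumes "bij f"
  shows "f [^]\<^bsub>(BijGroup UNIV)\<lparr>carrier := H\<rparr>\<^esub> (n::nat) = f ^^ n"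
proof (induction n)
  case (Suc n)
  with assms show ?case
    by (simp add: mult_BijGroup_UNIV bij_fn funpow_Suc_right del: funpow.simps)
qed (simp add: one_BijGroup_UNIV)

lemma one_mealy_group [simp]: "\<one>\<^bsub>mealy_group M\<^esub> = id"
  by (simp add: mealy_group_def one_BijGroup_UNIV)

lemma subgroup_mealy_group:
  assumes "mealy_invertible M"
  shows "subgroup (carrier (mealy_group M)) (BijGroup UNIV)"
proof -
  have "range (state_act M) \<subseteq> carrier (BijGroup UNIV)"
    using assms by (auto simp: carrier_BijGroup_UNIV bij_state_act)
  then show ?thesis
    using group.generate_is_subgroup[OF group_BijGroup] by (simp add: mealy_group_def)
qed

lemma bij_mealy_group:
  assumes "mealy_invertible M" "g \<in> carrier (mealy_group M)"
  shows "bij g"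
  using subgroup.subset[OF subgroup_mealy_group[OF assms(1)]] assms(2)
  by (auto simp: carrier_BijGroup_UNIV)

lemma pow_mealy_group:
  assumes "mealy_invertible M" "g \<in> carrier (mealy_group M)"
  shows "g [^]\<^bsub>mealy_group M\<^esub> (n::nat) = g ^^ n"
  using pow_BijGroup_UNIV[OF bij_mealy_group[OF assms]] by (simp add: mealy_group_def)

lemma state_prod_single [simp]: "state_prod M [q] = state_act M q"
  by (simp add: state_prod_def fun_eq_iff)

lemma tree_map_state_act [simp]: "tree_map (state_act M q)"
  using tree_map_state_prod[of M "[q]"] by simp

lemma tree_map_mealy_group:
  assumes "mealy_invertible M" "g \<in> carrier (mealy_group M)"
  shows "tree_map g"
proof -
  note G = mult_BijGroup_UNIV one_BijGroup_UNIV inv_BijGroup_UNIV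
  from assms(2) have "g \<in> generate (BijGroup UNIV) (range (state_act M))"
    by (simp add: mealy_group_def)
  then have "bij g \<and> tree_map g"
  proof induction
    case one
    show ?case by (simp only: G bij_id) (simp add: tree_map_def)
  next
    case (incl h)
    then show ?case using bij_state_act[OF assms(1)] by auto
  next
    case (inv h)
    then have "bij h" "tree_map h" using bij_state_act[OF assms(1)] by auto
    then show ?case by (simp add: G tree_map_inv bij_imp_bij_inv)
  next
    case (eng g h)
    then have "bij (g \<circ> h)" "tree_map (g \<circ> h)" by (metis bij_comp, metis tree_map_comp)
    with eng show ?case by (metis G(1))
  qed
  then show ?thesis by simp
qed

lemma state_prod_in_mealy_group:
  assumes "mealy_invertible M"
  shows "state_prod M u \<in> carrier (mealy_group M)"
proof (induction u)
  case Nil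
  show ?case
    using subgroup.one_closed[OF subgroup_mealy_group[OF assms]]
    by (simp only: one_BijGroup_UNIV state_prod_Nil)
next
  case (Cons q u)
  have "state_act M q \<in> carrier (mealy_group M)"
    by (auto simp: mealy_group_def intro: generate.incl)
  with Cons have "state_prod M u \<otimes>\<^bsub>BijGroup UNIV\<^esub> state_act M q \<in> carrier (mealy_group M)"
    by (rule subgroup.m_closed[OF subgroup_mealy_group[OF assms]])
  moreover have "state_prod M u \<otimes>\<^bsub>BijGroup UNIV\<^esub> state_act M q = state_prod M (q # u)"
    using assms by (simp add: mult_BijGroup_UNIV bij_state_prod bij_state_act)
      (simp add: fun_eq_iff state_prod_Cons)
  ultimately show ?case by simp
qed

text \<open>
  If some power of a positive word is trivial and that power is \<open>x q y\<close>, then \<open>y x\<close> is inverse to \<open>q\<close>.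
\<close>

lemma mealy_group_positive:
  assumes "mealy_invertible M"
    and tors: "\<And>q. \<exists>u. q \<in> set u \<and> finite_order (state_prod M u)"
    and "g \<in> carrier (mealy_group M)"
  obtains v where "g = state_prod M v"
proof -
  note G = mult_BijGroup_UNIV one_BijGroup_UNIV inv_BijGroup_UNIV
  from assms(3) have "g \<in> generate (BijGroup UNIV) (range (state_act M))"
    by (simp add: mealy_group_def)
  then have "\<exists>v. g = state_prod M v"
  proof induction
    case one
    show ?case by (rule exI[of _ "[]"]) (simp add: G)
  next
    case (incl h)
    then obtain q where "h = state_act M q" by auto
    then show ?case by (intro exI[of _ "[q]"]) simp
  next
    case (inv h)
    then obtain q where h: "h = state_act M q" by auto
    obtain u l where "q \<in> set u" "l \<ge> 1" "state_prod M (word_power l u) = id"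
      using tors[of q] by (auto simp: finite_order_def state_prod_word_power)
    moreover from this(1,2) have "q \<in> set (word_power l u)" by (cases l) auto
    ultimately obtain x y where id: "state_prod M (x @ q # y) = id" by (metis split_list)
    have "h (state_prod M (y @ x) w) = w" for w
    proof -
      have "state_prod M y (h (state_prod M (y @ x) w)) = state_prod M y w"
        using fun_cong[OF id, of "state_prod M y w"]
        by (simp add: h state_prod_append state_prod_Cons)
      then show ?thesis using bij_state_prod[OF assms(1)] by (metis bij_is_inj injD)
    qed
    moreover have "bij h" by (simp add: h bij_state_act assms(1))
    ultimately have "inv_into UNIV h = state_prod M (y @ x)"
      by (metis (no_types, lifting) bij_is_inj ext inv_f_eq)
    with \<open>bij h\<close> show ?case by (auto simp: G)
  next
    case (eng g h)
    then obtain u v where "g = state_prod M u" "h = state_prod M v" by auto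
    then have "g \<otimes>\<^bsub>BijGroup UNIV\<^esub> h = state_prod M (v @ u)"
      using assms(1) by (simp add: G bij_state_prod) (simp add: fun_eq_iff state_prod_append)
    then show ?case by blast
  qed
  with that show ?thesis by blast
qed

lemma Stab_iff:
  "g \<in> Stab M \<xi> \<longleftrightarrow> g \<in> carrier (mealy_group M) \<and> boundary_act g \<xi> = \<xi>"
  by (simp add: Stab_def stabilizer_def)

lemma torsion_group_Stab_iff:
  assumes "mealy_invertible M"
  shows "torsion_group ((mealy_group M)\<lparr>carrier := Stab M \<xi>\<rparr>) \<longleftrightarrow>
    (\<forall>g \<in> Stab M \<xi>. finite_order g)"
proof -
  let ?S = "(mealy_group M)\<lparr>carrier := Stab M \<xi>\<rparr>"
  have S: "?S = (BijGroup UNIV)\<lparr>carrier := Stab M \<xi>\<rparr>" by (simp add: mealy_group_def)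
  note sub = subgroup_mealy_group[OF assms]
  note bij = bij_mealy_group[OF assms] and tree = tree_map_mealy_group[OF assms]
  have "subgroup (Stab M \<xi>) (BijGroup UNIV)"
  proof (rule subgroup.intro)
    show "Stab M \<xi> \<subseteq> carrier (BijGroup UNIV)"
      using bij by (auto simp: Stab_iff carrier_BijGroup_UNIV)
    show "\<one>\<^bsub>BijGroup UNIV\<^esub> \<in> Stab M \<xi>"
      using subgroup.one_closed[OF sub] by (simp add: Stab_iff one_BijGroup_UNIV)
  next
    fix g h assume gh: "g \<in> Stab M \<xi>" "h \<in> Stab M \<xi>"
    then have "boundary_act (g \<circ> h) \<xi> = \<xi>" by (simp add: Stab_iff boundary_act_comp tree)
    moreover have "g \<otimes>\<^bsub>BijGroup UNIV\<^esub> h = g \<circ> h"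
      using gh bij by (simp add: Stab_iff mult_BijGroup_UNIV)
    ultimately show "g \<otimes>\<^bsub>BijGroup UNIV\<^esub> h \<in> Stab M \<xi>"
      using gh subgroup.m_closed[OF sub, of g h] by (simp add: Stab_iff)
  next
    fix g assume g: "g \<in> Stab M \<xi>"
    then have bg: "bij g" and tg: "tree_map g" using bij tree by (auto simp: Stab_iff)
    have "inv_into UNIV g \<circ> g = id" using bg by (simp add: bij_is_inj)
    then have "boundary_act (inv_into UNIV g) (boundary_act g \<xi>) = \<xi>"
      using boundary_act_comp[OF tree_map_inv[OF tg bg] tg, of \<xi>] by simp
    with g have "boundary_act (inv_into UNIV g) \<xi> = \<xi>" by (simp add: Stab_iff)
    with g bg show "inv\<^bsub>BijGroup UNIV\<^esub> g \<in> Stab M \<xi>"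
      using subgroup.m_inv_closed[OF sub, of g] by (simp add: Stab_iff inv_BijGroup_UNIV)
  qed
  then have "group ?S" unfolding S by (rule subgroup.subgroup_is_group[OF _ group_BijGroup])
  moreover have "g [^]\<^bsub>?S\<^esub> n = g ^^ n" if "g \<in> Stab M \<xi>" for g and n :: nat
    unfolding S using that bij by (intro pow_BijGroup_UNIV) (simp add: Stab_iff)
  moreover have "\<one>\<^bsub>?S\<^esub> = id" by (simp add: one_BijGroup_UNIV)
  ultimately show ?thesis by (simp add: torsion_group_def finite_order_def)
qed

section \<open>Boundary stabilizers and commuting pairs\<close>

text \<open>
  A commuting pair puts \<open>u\<close> into the stabilizer of \<open>w\<^sup>\<omega>\<close>. For the converse, the inverses of states
  are eliminated, after which the stabilizers contain positive words only.
\<close>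

theorem stabilizers_torsion_iff_commuting_torsion:
  fixes M :: "('q::finite, 'a::finite) mealy"
  assumes "mealy_invertible M" "mealy_reversible M"
  shows "(\<forall>\<xi>. torsion_group ((mealy_group M)\<lparr>carrier := Stab M \<xi>\<rparr>)) \<longleftrightarrow> commuting_torsion M"
    (is "?L \<longleftrightarrow> ?R")
proof
  assume ?L
  then have fin: "finite_order g" if "g \<in> Stab M \<xi>" for g \<xi>
    using torsion_group_Stab_iff[OF assms(1)] that by blast
  show ?R unfolding commuting_torsion_def
  proof (intro allI impI)
    fix u :: "'q list" and w :: "'a list"
    assume "w \<noteq> []" "commuting M u w"
    then have "state_prod M u \<in> Stab M (w\<^sup>\<omega>)"
      by (simp add: Stab_iff commuting_fixes_iter state_prod_in_mealy_group assms(1))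
    then show "finite_order (state_prod M u)" by (rule fin)
  qed
next
  assume R: ?R
  have tors: "\<exists>u. q \<in> set u \<and> finite_order (state_prod M u)" for q
    using commuting_pair_through_state[OF assms, of q] R unfolding commuting_torsion_def
    by (metis list.set(1) empty_iff)
  have "finite_order g" if g: "g \<in> Stab M \<xi>" for g \<xi>
  proof -
    obtain v where "g = state_prod M v"
      using mealy_group_positive[OF assms(1) tors] g by (auto simp: Stab_iff)
    with g fixing_word_finite_order[OF assms(2) R] show ?thesis by (metis Stab_iff)
  qed
  then show ?L by (simp add: torsion_group_Stab_iff[OF assms(1)])
qed

text \<open>
  A trivial word \<open>w\<close> of the dual fixes every \<open>u\<close>, and \<open>u\<close> permutes the words as long as \<open>w\<close>, so a
  power of \<open>u\<close> commutes with \<open>w\<close>. Then every positive word has finite order, and with it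
  every element of the group.
\<close>

lemma positive_relations_empty:
  fixes M :: "('q::finite, 'a::finite) mealy"
  assumes "mealy_invertible M"
    and R: "commuting_torsion M"
    and "g \<in> carrier (mealy_group M)" "\<not> finite_order g"
  shows "positive_relations (dual_mealy M) = {}"
proof (rule ccontr)
  assume "positive_relations (dual_mealy M) \<noteq> {}"
  then obtain w where w: "w \<noteq> []" "state_prod (dual_mealy M) w = id"
    by (auto simp: positive_relations_def)
  have tors: "finite_order (state_prod M u)" for u
  proof (cases "u = []")
    case True
    then show ?thesis by (auto simp: finite_order_def intro: exI[of _ 1])
  next
    case False
    obtain l where l: "l \<ge> 1" "(state_prod M u ^^ l) w = w"
      using state_prod_recurrent[OF assms(1)] by blast
    then have "commuting M (word_power l u) w"
      by (simp add: commuting_def state_prod_word_power w(2))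
    with R l(1) w(1) False have "finite_order (state_prod M (word_power l u))"
      unfolding commuting_torsion_def by simp
    with l(1) show ?thesis by (simp add: state_prod_word_power finite_order_funpow_iff)
  qed
  then have "\<exists>u. q \<in> set u \<and> finite_order (state_prod M u)" for q
    by (intro exI[of _ "[q]"]) (metis list.set_intros(1))
  then obtain v where "g = state_prod M v"
    using mealy_group_positive[OF assms(1) _ assms(3)] by metis
  with tors assms(4) show False by simp
qed

lemma Stab_pos_nontrivial_iff:
  assumes "mealy_invertible M" "positive_relations M = {}"
  shows "Stab_pos M \<xi> \<noteq> {\<one>\<^bsub>mealy_group M\<^esub>} \<longleftrightarrow>
    (\<exists>w. w \<noteq> [] \<and> boundary_act (state_prod M w) \<xi> = \<xi>)"
proof -
  have "id \<in> Stab_pos M \<xi>"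
    using state_prod_in_mealy_group[OF assms(1), of "[]"]
    by (auto simp: Stab_pos_def Stab_iff intro: exI[of _ "[]"])
  then have "Stab_pos M \<xi> \<noteq> {id} \<longleftrightarrow> (\<exists>g \<in> Stab_pos M \<xi>. g \<noteq> id)" by blast
  also have "\<dots> \<longleftrightarrow> (\<exists>w. state_prod M w \<noteq> id \<and> boundary_act (state_prod M w) \<xi> = \<xi>)"
    using state_prod_in_mealy_group[OF assms(1)] by (auto simp: Stab_pos_def Stab_iff)
  also have "\<dots> \<longleftrightarrow> (\<exists>w. w \<noteq> [] \<and> boundary_act (state_prod M w) \<xi> = \<xi>)"
  proof -
    have "state_prod M w \<noteq> id \<longleftrightarrow> w \<noteq> []" for w
      using assms(2) by (auto simp: positive_relations_def)
    then show ?thesis by simp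
  qed
  finally show ?thesis by simp
qed

text \<open>
  If a power of \<open>u\<close> is trivial, it fixes every word of letters; a power of any single letter fixes it
  in return, as the letter permutes the words of that length.
\<close>

lemma finite_order_imp_dual_fixes_iter:
  fixes M :: "('q::finite, 'a) mealy"
  assumes "mealy_reversible M" "u \<noteq> []" "finite_order (state_prod M u)"
  shows "\<exists>w. w \<noteq> [] \<and> boundary_act (state_prod (dual_mealy M) w) (u\<^sup>\<omega>) = u\<^sup>\<omega>"
proof -
  let ?D = "dual_mealy M" and ?a = "[undefined] :: 'a list"
  obtain l where l: "l \<ge> 1" "state_prod M (word_power l u) = id"
    using assms(3) by (auto simp: finite_order_def state_prod_word_power)
  obtain k where k: "k \<ge> 1"
    "(state_prod ?D ?a ^^ k) (word_power l u) = word_power l u"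
    using state_prod_recurrent[of ?D ?a "word_power l u"] assms(1) mealy_invertible_dual by metis
  have "commuting ?D (word_power k ?a) (word_power l u)"
    using l k unfolding commuting_def by (simp only: dual_dual state_prod_word_power id_apply)
  then have "boundary_act (state_prod ?D (word_power k ?a)) ((word_power l u)\<^sup>\<omega>) = (word_power l u)\<^sup>\<omega>"
    by (rule commuting_fixes_iter) (use l(1) assms(2) in simp)
  then show ?thesis using l(1) k(1) assms(2)
    by (intro exI[of _ "word_power k ?a"]) (simp add: iter_word_power)
qed

lemma commuting_torsion_fixes_iter:
  fixes M :: "('q::finite, 'a::finite) mealy"
  assumes "mealy_invertible M" "commuting_torsion M"
    and "u \<noteq> []" "w \<noteq> []" "boundary_act (state_prod (dual_mealy M) w) (u\<^sup>\<omega>) = u\<^sup>\<omega>"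
  shows "finite_order (state_prod M u)"
proof -
  obtain l where l: "l \<ge> 1" "commuting (dual_mealy M) w (word_power l u)"
    using fixes_iter_commuting[OF _ assms(5,3)] assms(1) by auto
  then have "finite_order (state_prod M (word_power l u))"
    using assms(2-4) by (simp add: commuting_torsion_def commuting_dual)
  with l(1) show ?thesis by (simp add: state_prod_word_power finite_order_funpow_iff)
qed

theorem positive_stabilizers_iff_commuting_torsion:
  fixes M :: "('q::finite, 'a::finite) mealy"
  assumes inv: "mealy_invertible M" and rev: "mealy_reversible M"
    and "g \<in> carrier (mealy_group M)" "\<not> finite_order g"
  shows "positive_relations (dual_mealy M) = {} \<and>
      (\<forall>u. u \<noteq> [] \<longrightarrow>
        (Stab_pos (dual_mealy M) (u\<^sup>\<omega>) \<noteq> {\<one>\<^bsub>mealy_group (dual_mealy M)\<^esub>} \<longleftrightarrow>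
         finite_order (state_prod M u))) \<longleftrightarrow> commuting_torsion M"
    (is "?P \<and> ?Q \<longleftrightarrow> ?R")
proof
  assume L: "?P \<and> ?Q"
  show ?R unfolding commuting_torsion_def
  proof (intro allI impI)
    fix u :: "'q list" and w :: "'a list"
    assume "u \<noteq> []" "w \<noteq> []" "commuting M u w"
    then have "boundary_act (state_prod (dual_mealy M) w) (u\<^sup>\<omega>) = u\<^sup>\<omega>"
      by (simp add: commuting_fixes_iter commuting_dual)
    with L \<open>u \<noteq> []\<close> \<open>w \<noteq> []\<close> show "finite_order (state_prod M u)"
      using Stab_pos_nontrivial_iff[of "dual_mealy M"] rev by (metis mealy_invertible_dual)
  qed
next
  assume R: ?R
  have P: ?P by (rule positive_relations_empty[OF inv R assms(3,4)])
  moreover have ?Q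
    using Stab_pos_nontrivial_iff[OF _ P] rev finite_order_imp_dual_fixes_iter[OF rev]
      commuting_torsion_fixes_iter[OF inv R] by (metis mealy_invertible_dual)
  ultimately show "?P \<and> ?Q" by blast
qed


section \<open>Orbital graphs of periodic words\<close>

lemma boundary_act_state_prod_Cons:
  "boundary_act (state_prod N (s # w)) \<eta> = boundary_act (state_prod N w) (boundary_act (state_act N s) \<eta>)"
proof -
  have "state_prod N (s # w) = state_prod N w \<circ> state_act N s"
    by (simp add: fun_eq_iff state_prod_Cons)
  then show ?thesis by (simp only: boundary_act_comp tree_map_state_prod tree_map_state_act)
qed

lemma arcs_ends_mk_symmetric_boundary_graph:
  "(\<eta>, \<eta>') \<in> arcs_ends (mk_symmetric (boundary_graph N)) \<longleftrightarrow>
     (\<exists>s. \<eta>' = boundary_act (state_act N s) \<eta> \<or> \<eta> = boundary_act (state_act N s) \<eta>')"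
  by (auto simp: parcs_mk_symmetric boundary_graph_def)

lemma verts_orbital_graph:
  "verts (orbital_graph N \<xi>) = {\<eta>. (\<xi>, \<eta>) \<in> rtrancl_on UNIV (arcs_ends (mk_symmetric (boundary_graph N)))}"
  by (simp add: orbital_graph_def reachable_def boundary_graph_def)

lemma orbital_graph_base: "\<xi> \<in> verts (orbital_graph N \<xi>)"
  by (simp add: verts_orbital_graph)

lemma orbital_graph_step:
  "\<eta> \<in> verts (orbital_graph N \<xi>) \<Longrightarrow> boundary_act (state_act N s) \<eta> \<in> verts (orbital_graph N \<xi>)"
  unfolding verts_orbital_graph mem_Collect_eq
  by (erule rtrancl_on_into_rtrancl_on)
     (use arcs_ends_mk_symmetric_boundary_graph in blast)+

lemma orbital_graph_induct [consumes 1, case_names base forward backward]: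
  assumes "\<eta> \<in> verts (orbital_graph N \<xi>)"
    and "P \<xi>"
    and "\<And>\<eta> s. P \<eta> \<Longrightarrow> P (boundary_act (state_act N s) \<eta>)"
    and "\<And>\<eta> s. P (boundary_act (state_act N s) \<eta>) \<Longrightarrow> P \<eta>"
  shows "P \<eta>"
proof -
  have "(\<xi>, \<eta>) \<in> rtrancl_on UNIV (arcs_ends (mk_symmetric (boundary_graph N)))"
    using assms(1) by (simp add: verts_orbital_graph)
  then show ?thesis
  proof (induction rule: rtrancl_on_induct)
    case base
    show ?case by (rule assms(2))
  next
    case (step \<eta> \<eta>')
    then show ?case
      using assms(3,4) unfolding arcs_ends_mk_symmetric_boundary_graph by blast
  qed
qed

lemma orbital_graph_eq:
  assumes "\<eta> \<in> verts (orbital_graph N \<xi>)"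
  shows "orbital_graph N \<xi> = orbital_graph N \<eta>"
proof -
  let ?R = "rtrancl_on UNIV (arcs_ends (mk_symmetric (boundary_graph N)))"
  have "(arcs_ends (mk_symmetric (boundary_graph N)))\<inverse> = arcs_ends (mk_symmetric (boundary_graph N))"
    using symmetric_mk_symmetric[of "boundary_graph N"] by (simp add: symmetric_def sym_conv_converse_eq)
  then have "(\<eta>', \<eta>) \<in> ?R" if "(\<eta>, \<eta>') \<in> ?R" for \<eta> \<eta>'
    using rtrancl_on_converseI[OF that] by simp
  moreover have "(\<xi>, \<eta>) \<in> ?R" using assms by (simp add: verts_orbital_graph)
  ultimately have "(\<xi>, \<zeta>) \<in> ?R \<longleftrightarrow> (\<eta>, \<zeta>) \<in> ?R" for \<zeta> by (meson rtrancl_on_trans)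
  then show ?thesis by (simp add: orbital_graph_def reachable_def boundary_graph_def)
qed

lemma arcs_orbital_graph: "arcs (orbital_graph N \<xi>) = verts (orbital_graph N \<xi>) \<times> UNIV"
  using orbital_graph_step[of _ N \<xi>]
  by (auto simp: orbital_graph_def) (auto simp: boundary_graph_def)

lemma tail_orbital_graph [simp]: "tail (orbital_graph N \<xi>) e = fst e"
  and head_orbital_graph [simp]:
    "head (orbital_graph N \<xi>) (\<eta>, s) = boundary_act (state_act N s) \<eta>"
  by (simp_all add: orbital_graph_def boundary_graph_def)

lemma wf_digraph_orbital_graph: "wf_digraph (orbital_graph N \<xi>)"
  by unfold_locales (auto simp: arcs_orbital_graph orbital_graph_step)

lemma fin_digraph_orbital_graph_iff:
  fixes N :: "('s::finite, 'x) mealy"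
  shows "fin_digraph (orbital_graph N \<xi>) \<longleftrightarrow> finite (verts (orbital_graph N \<xi>))"
  using wf_digraph_orbital_graph[of N \<xi>]
  by (auto simp: fin_digraph_def fin_digraph_axioms_def arcs_orbital_graph)

text \<open>
  Reading off labels turns directed walks into words of states. A closed walk need not be a cycle,
  but it contains one.
\<close>

lemma acyclic_orbital_graph_iff:
  "acyclic_multidigraph (orbital_graph N \<xi>) \<longleftrightarrow>
     \<not> (\<exists>\<eta> \<in> verts (orbital_graph N \<xi>). \<exists>w. w \<noteq> [] \<and> boundary_act (state_prod N w) \<eta> = \<eta>)"
proof -
  interpret wf_digraph "orbital_graph N \<xi>" by (rule wf_digraph_orbital_graph)
  have walk: "\<exists>p. length p = length w \<and> awalk \<eta> p (boundary_act (state_prod N w) \<eta>)"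
    if "\<eta> \<in> verts (orbital_graph N \<xi>)" for \<eta> w
    using that
  proof (induction w arbitrary: \<eta>)
    case (Cons s w)
    obtain p where "length p = length w"
      "awalk (boundary_act (state_act N s) \<eta>) p (boundary_act (state_prod N (s # w)) \<eta>)"
      using Cons.IH[OF orbital_graph_step[OF Cons.prems]]
      by (auto simp only: boundary_act_state_prod_Cons)
    with Cons.prems show ?case
      by (intro exI[of _ "(\<eta>, s) # p"]) (simp add: awalk_Cons_iff arcs_orbital_graph)
  qed (auto simp: awalk_Nil_iff)
  have word: "\<eta>' = boundary_act (state_prod N (map snd p)) \<eta>" if "awalk \<eta> p \<eta>'" for \<eta> p \<eta>'
    using that
  proof (induction p arbitrary: \<eta>)
    case (Cons e p)
    then show ?case
      by (cases e) (auto simp: awalk_Cons_iff boundary_act_state_prod_Cons)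
  qed (auto simp: awalk_Nil_iff)
  show ?thesis
  proof
    assume acyc: "acyclic_multidigraph (orbital_graph N \<xi>)"
    show "\<not> (\<exists>\<eta> \<in> verts (orbital_graph N \<xi>). \<exists>w. w \<noteq> [] \<and> boundary_act (state_prod N w) \<eta> = \<eta>)"
    proof clarify
      fix \<eta> w assume "\<eta> \<in> verts (orbital_graph N \<xi>)" "boundary_act (state_prod N w) \<eta> = \<eta>" "w \<noteq> []"
      with walk[of \<eta> w] obtain p where "length p = length w" "awalk \<eta> p \<eta>" by auto
      with \<open>w \<noteq> []\<close> have "closed_w p" by (auto simp: closed_w_def)
      with acyc closed_w_imp_cycle show False by (auto simp: acyclic_multidigraph_def)
    qed
  next
    assume "\<not> (\<exists>\<eta> \<in> verts (orbital_graph N \<xi>). \<exists>w. w \<noteq> [] \<and> boundary_act (state_prod N w) \<eta> = \<eta>)"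
    moreover have "\<exists>\<eta> \<in> verts (orbital_graph N \<xi>). \<exists>w. w \<noteq> [] \<and> boundary_act (state_prod N w) \<eta> = \<eta>"
      if cyc: "cycle p" for p
    proof -
      obtain \<eta> where "awalk \<eta> p \<eta>" "p \<noteq> []" using cyc by (auto simp: cycle_def)
      then have "boundary_act (state_prod N (map snd p)) \<eta> = \<eta>" "map snd p \<noteq> []"
        "\<eta> \<in> verts (orbital_graph N \<xi>)"
        using word[of \<eta> p \<eta>] by auto
      then show ?thesis by blast
    qed
    ultimately show "acyclic_multidigraph (orbital_graph N \<xi>)"
      unfolding acyclic_multidigraph_def by blast
  qed
qed

lemma state_act_image_periodic:
  fixes N :: "('s::finite, 'x) mealy"
  assumes "mealy_reversible N" "x \<noteq> []"
  shows "\<exists>y. y \<noteq> [] \<and> boundary_act (state_act N s) (x\<^sup>\<omega>) = y\<^sup>\<omega>"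
proof -
  obtain l where l: "l \<ge> 1" "(state_prod (dual_mealy N) x ^^ l) [s] = [s]"
    using state_prod_recurrent[of "dual_mealy N" x "[s]"] assms(1) mealy_invertible_dual by metis
  then have "boundary_act (state_act N s) ((word_power l x)\<^sup>\<omega>) = (state_act N s (word_power l x))\<^sup>\<omega>"
    using boundary_act_iter[of N "word_power l x" "[s]"] assms(2) by (simp add: state_prod_word_power)
  moreover have "state_act N s (word_power l x) \<noteq> []"
    using l assms(2) by (metis length_0_conv length_state_act word_power_eq_Nil_iff not_one_le_zero)
  ultimately show ?thesis using l(1) assms(2) by (auto simp: iter_word_power)
qed

text \<open>
  Walking an edge backwards is an application of the inverse automaton, whose reversibility is the
  third condition of bireversibility.
\<close>

lemma orbital_graph_periodic:
  fixes N :: "('s::finite, 'x) mealy"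
  assumes "mealy_bireversible N" "x \<noteq> []" "\<eta> \<in> verts (orbital_graph N (x\<^sup>\<omega>))"
  shows "\<exists>y. y \<noteq> [] \<and> \<eta> = y\<^sup>\<omega>"
  using assms(3)
proof (induction rule: orbital_graph_induct)
  case base
  show ?case using assms(2) by blast
next
  case (forward \<eta> s)
  then show ?case
    using state_act_image_periodic[of N] assms(1) by (auto simp: mealy_bireversible_iff)
next
  case (backward \<eta> s)
  then obtain y where y: "y \<noteq> []" "boundary_act (state_act N s) \<eta> = y\<^sup>\<omega>" by blast
  have "state_act (inverse_mealy N) s \<circ> state_act N s = id"
    using assms(1) by (simp add: fun_eq_iff mealy_bireversible_iff state_act_inverse_mealy)
  then have "\<eta> = boundary_act (state_act (inverse_mealy N) s) (y\<^sup>\<omega>)"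
    using boundary_act_comp[OF tree_map_state_act tree_map_state_act, of "inverse_mealy N" s N s \<eta>]
    by (simp only: y(2) boundary_act_id)
  with y(1) state_act_image_periodic[of "inverse_mealy N"] assms(1) show ?case
    by (auto simp: mealy_bireversible_iff)
qed

text \<open>
  Letters send trivial words to trivial words of the same length. The periodic points
  spanned by these form a finite set that each letter maps injectively into itself, hence onto itself,
  so the set is closed under edges in both directions.
\<close>

lemma finite_order_imp_finite_orbital_graph:
  fixes M :: "('q::finite, 'a::finite) mealy"
  assumes "mealy_reversible M" "u \<noteq> []" "finite_order (state_prod M u)"
  shows "finite (verts (orbital_graph (dual_mealy M) (u\<^sup>\<omega>)))"
proof -
  let ?D = "dual_mealy M"
  obtain l where l: "l \<ge> 1" "state_prod M (word_power l u) = id"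
    using assms(3) by (auto simp: finite_order_def state_prod_word_power)
  define v where "v = word_power l u"
  have v: "v \<noteq> []" "state_prod M v = id" "v\<^sup>\<omega> = u\<^sup>\<omega>"
    using l assms(2) by (simp_all add: v_def iter_word_power)
  define S where "S = iter ` {x. length x = length v \<and> state_prod M x = id}"
  have "finite {x :: 'q list. set x \<subseteq> UNIV \<and> length x = length v}"
    by (rule finite_lists_length_eq) simp
  then have "finite S" by (auto simp: S_def)
  have forward: "boundary_act (state_act ?D a) \<eta> \<in> S" if "\<eta> \<in> S" for \<eta> a
  proof -
    obtain x where x: "\<eta> = x\<^sup>\<omega>" "length x = length v" "state_prod M x = id"
      using \<open>\<eta> \<in> S\<close> by (auto simp: S_def)
    moreover have "x \<noteq> []" using x(2) v(1) by auto
    ultimately have "boundary_act (state_act ?D a) \<eta> = (state_act ?D a x)\<^sup>\<omega>"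
      using boundary_act_iter[of ?D x "[a]"] by simp
    moreover have "state_prod M (state_act ?D a x) = id"
      using section_of_trivial_word[OF x(3), of "[a]"] by simp
    ultimately show ?thesis using x(2) by (auto simp: S_def)
  qed
  have backward: "\<eta> \<in> S" if "boundary_act (state_act ?D a) \<eta> \<in> S" for \<eta> a
  proof -
    have inj: "inj (state_act ?D a)" using bij_state_act[of ?D a] assms(1) by (simp add: bij_is_inj)
    then have "inj_on (boundary_act (state_act ?D a)) S"
      by (auto intro!: inj_onI dest: boundary_act_inj[OF tree_map_state_act])
    moreover have "boundary_act (state_act ?D a) ` S \<subseteq> S"
      by (rule image_subsetI) (rule forward)
    ultimately have "boundary_act (state_act ?D a) ` S = S"
      using \<open>finite S\<close> by (metis endo_inj_surj)
    with that have "boundary_act (state_act ?D a) \<eta> \<in> boundary_act (state_act ?D a) ` S"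
      by (simp only:)
    then obtain \<eta>' where \<eta>': "\<eta>' \<in> S"
      "boundary_act (state_act ?D a) \<eta> = boundary_act (state_act ?D a) \<eta>'"
      by (rule imageE) (rule that)
    have "\<eta> = \<eta>'" by (rule boundary_act_inj[OF tree_map_state_act inj \<eta>'(2)])
    with \<eta>'(1) show ?thesis by (simp only:)
  qed
  have "u\<^sup>\<omega> \<in> S"
    unfolding S_def by (rule image_eqI[of _ _ v]) (simp_all add: v)
  have "\<eta> \<in> S" if "\<eta> \<in> verts (orbital_graph ?D (u\<^sup>\<omega>))" for \<eta>
    using that
  proof (induction rule: orbital_graph_induct)
    case base
    show ?case by fact
  qed (erule forward, erule backward)
  with \<open>finite S\<close> show ?thesis by (metis finite_subset subsetI)
qed

lemma common_period:
  assumes "finite V" "\<And>\<eta>. \<eta> \<in> V \<Longrightarrow> \<exists>y. y \<noteq> [] \<and> \<eta> = y\<^sup>\<omega>"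
  shows "\<exists>L\<ge>1. \<forall>\<eta>\<in>V. \<exists>y. length y = L \<and> \<eta> = y\<^sup>\<omega>"
  using assms
proof (induction V rule: finite_induct)
  case (insert \<eta> V)
  then obtain L where L: "L \<ge> 1" "\<forall>\<eta>\<in>V. \<exists>y. length y = L \<and> \<eta> = y\<^sup>\<omega>" by auto
  obtain y where y: "y \<noteq> []" "\<eta> = y\<^sup>\<omega>" using insert.prems[of \<eta>] by auto
  have "\<exists>x. length x = L * length y \<and> \<zeta> = x\<^sup>\<omega>" if "\<zeta> \<in> V" for \<zeta>
  proof -
    obtain z where "length z = L" "\<zeta> = z\<^sup>\<omega>" using L \<open>\<zeta> \<in> V\<close> by blast
    moreover from this(1) L(1) have "z \<noteq> []" by auto
    ultimately show ?thesis using y(1)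
      by (intro exI[of _ "word_power (length y) z"]) (simp add: iter_word_power Suc_le_eq)
  qed
  moreover have "\<exists>x. length x = L * length y \<and> \<eta> = x\<^sup>\<omega>"
    using y L(1) by (intro exI[of _ "word_power L y"]) (simp add: iter_word_power)
  moreover have "L * length y \<ge> 1" using L(1) y(1) by (simp add: Suc_le_eq)
  ultimately show ?case by blast
qed auto

lemma bij_exponent:
  obtains l where "l \<ge> 1" "\<And>f :: 'x::finite \<Rightarrow> 'x. bij f \<Longrightarrow> f ^^ l = id"
proof -
  let ?G = "BijGroup (UNIV :: 'x set)"
  interpret group ?G by (rule group_BijGroup)
  have "finite (carrier ?G)" by simp
  then have "order ?G \<ge> 1" using order_gt_0_iff_finite by simp
  moreover have "f ^^ order ?G = id" if "bij f" for f :: "'x \<Rightarrow> 'x"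
  proof -
    have "f [^]\<^bsub>?G\<^esub> order ?G = \<one>\<^bsub>?G\<^esub>"
      using that by (intro pow_order_eq_1) (simp add: carrier_BijGroup_UNIV)
    then show ?thesis
      using pow_BijGroup_UNIV[OF that, of "carrier ?G"] nat_pow_consistent[of f _ "carrier ?G"]
      by (metis one_BijGroup_UNIV)
  qed
  ultimately show ?thesis using that by blast
qed

text \<open>
  Replace \<open>u\<close> by a power \<open>v\<close> whose length is a period of all points of the orbit. Then every word
  \<open>w\<close> sends powers of \<open>v\<close> to powers of the image of \<open>v\<close>. If \<open>l\<close> is an exponent of the
  symmetric group on the alphabet, all sections of the \<open>l\<close>-th power of \<open>v\<close> are \<open>l\<close>-th powers and
  fix every single letter; so this power is trivial.
\<close>

lemma finite_orbital_graph_imp_finite_order: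
  fixes M :: "('q::finite, 'a::finite) mealy"
  assumes "mealy_bireversible M" "u \<noteq> []"
    and "finite (verts (orbital_graph (dual_mealy M) (u\<^sup>\<omega>)))"
  shows "finite_order (state_prod M u)"
proof -
  let ?D = "dual_mealy M" and ?V = "verts (orbital_graph (dual_mealy M) (u\<^sup>\<omega>))"
  obtain L where L: "L \<ge> 1" "\<forall>\<eta>\<in>?V. \<exists>y. length y = L \<and> \<eta> = y\<^sup>\<omega>"
    using common_period[OF assms(3)] orbital_graph_periodic[OF mealy_bireversible_dual[OF assms(1)] assms(2)]
    by blast
  \<comment> \<open>This length is a multiple both of the common period and of the length of \<open>u\<close>.\<close>
  define v where "v = word_power L u"
  have v: "v \<noteq> []" "v\<^sup>\<omega> = u\<^sup>\<omega>" using L(1) assms(2) by (simp_all add: v_def iter_word_power)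
  have orbit: "boundary_act (state_prod ?D w) \<eta> \<in> ?V" if "\<eta> \<in> ?V" for w \<eta>
    using that
    by (induction w arbitrary: \<eta>) (simp_all only: boundary_act_state_prod_Cons orbital_graph_step state_prod_Nil boundary_act_id)
  have power: "state_prod ?D w (word_power n v) = word_power n (state_prod ?D w v)" for w n
  proof -
    obtain z where z: "length z = L" "boundary_act (state_prod ?D w) (u\<^sup>\<omega>) = z\<^sup>\<omega>"
      using orbit[OF orbital_graph_base] L(2) by blast
    define y where "y = word_power (length u) z"
    have "z \<noteq> []" using z(1) L(1) by auto
    then have vy: "boundary_act (state_prod ?D w) (v\<^sup>\<omega>) = y\<^sup>\<omega>" "length v = length y" "y \<noteq> []"
      using z v(2) assms(2) by (simp_all add: y_def v_def iter_word_power Suc_le_eq mult.commute)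
    have "state_prod ?D w (word_power k v) = word_power k y" for k
      by (rule boundary_act_iter_power[OF vy])
    from this[of n] this[of 1] show ?thesis by simp
  qed
  obtain l where l: "l \<ge> 1" "\<And>f :: 'a \<Rightarrow> 'a. bij f \<Longrightarrow> f ^^ l = id" by (rule bij_exponent) blast
  have letter: "state_prod M (word_power l x) [a] = [a]" for x a
  proof -
    define f where "f = (\<lambda>a. hd (state_prod M x [a]))"
    have f: "state_prod M x [a] = [f a]" for a
      using length_state_prod[of M x "[a]"] by (cases "state_prod M x [a]") (auto simp: f_def)
    have "inj f"
    proof (rule injI)
      fix a b assume "f a = f b"
      then have "state_prod M x [a] = state_prod M x [b]" by (simp add: f)
      then show "a = b"
        using bij_state_prod[of M x] assms(1) by (metis bij_is_inj injD list.inject mealy_bireversible_iff)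
    qed
    then have "bij f" by (simp add: bij_def finite_UNIV_inj_surj)
    then have "f ^^ l = id" by (rule l(2))
    moreover have "(state_prod M x ^^ n) [a] = [(f ^^ n) a]" for n by (induction n) (simp_all add: f)
    ultimately show ?thesis by (simp add: state_prod_word_power)
  qed
  have "state_prod M (word_power l v) w = w" for w
  proof (induction w rule: rev_induct)
    case (snoc a w)
    then show ?case by (simp add: state_prod_append_word power letter)
  qed simp
  then have "state_prod M (word_power l v) = id" by (simp add: fun_eq_iff)
  then have "state_prod M (word_power (l * L) u) = id"
    by (simp add: v_def state_prod_word_power funpow_mult mult.commute)
  with l(1) L(1) show ?thesis
    unfolding finite_order_def state_prod_word_power by (intro exI[of _ "l * L"]) simp
qed

text \<open>
  A commuting pair \<open>(u, w)\<close> puts a cycle at \<open>u\<^sup>\<omega>\<close>. Conversely a cycle need not pass through \<open>v\<^sup>\<omega>\<close>, but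
  the component can be rooted at any of its points, and all of them are periodic.
\<close>

theorem orbital_graphs_iff_commuting_torsion:
  fixes M :: "('q::finite, 'a::finite) mealy"
  assumes "mealy_bireversible M"
  shows "(\<forall>v. v \<noteq> [] \<longrightarrow>
      fin_digraph (orbital_graph (dual_mealy M) (v\<^sup>\<omega>)) \<or>
      acyclic_multidigraph (orbital_graph (dual_mealy M) (v\<^sup>\<omega>))) \<longleftrightarrow> commuting_torsion M"
    (is "?L \<longleftrightarrow> ?R")
proof
  let ?D = "dual_mealy M"
  assume L: ?L
  show ?R unfolding commuting_torsion_def
  proof (intro allI impI)
    fix u :: "'q list" and w :: "'a list"
    assume uw: "u \<noteq> []" "w \<noteq> []" "commuting M u w"
    then have "boundary_act (state_prod ?D w) (u\<^sup>\<omega>) = u\<^sup>\<omega>"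
      by (simp add: commuting_fixes_iter commuting_dual)
    with uw(2) have "\<not> acyclic_multidigraph (orbital_graph ?D (u\<^sup>\<omega>))"
      using orbital_graph_base by (auto simp: acyclic_orbital_graph_iff)
    with L uw(1) have "finite (verts (orbital_graph ?D (u\<^sup>\<omega>)))"
      by (auto simp: fin_digraph_orbital_graph_iff)
    then show "finite_order (state_prod M u)"
      by (rule finite_orbital_graph_imp_finite_order[OF assms uw(1)])
  qed
next
  let ?D = "dual_mealy M"
  assume R: ?R
  have inv: "mealy_invertible M" and rev: "mealy_reversible M"
    using assms by (simp_all add: mealy_bireversible_iff)
  show ?L
  proof (intro allI impI disjCI)
    fix v :: "'q list"
    assume v: "v \<noteq> []" "\<not> acyclic_multidigraph (orbital_graph ?D (v\<^sup>\<omega>))"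
    then obtain \<eta> w where w: "\<eta> \<in> verts (orbital_graph ?D (v\<^sup>\<omega>))" "w \<noteq> []"
      "boundary_act (state_prod ?D w) \<eta> = \<eta>"
      by (auto simp: acyclic_orbital_graph_iff)
    obtain y where y: "y \<noteq> []" "\<eta> = y\<^sup>\<omega>"
      using orbital_graph_periodic[OF mealy_bireversible_dual[OF assms] v(1) w(1)] by blast
    have "finite_order (state_prod M y)"
      using commuting_torsion_fixes_iter[OF inv R y(1) w(2)] w(3) y(2) by simp
    then have "finite (verts (orbital_graph ?D \<eta>))"
      using finite_order_imp_finite_orbital_graph[OF rev y(1)] y(2) by simp
    then show "fin_digraph (orbital_graph ?D (v\<^sup>\<omega>))"
      by (simp only: orbital_graph_eq[OF w(1)] fin_digraph_orbital_graph_iff)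
  qed
qed

section \<open>The equivalences\<close>

theorem theorem5p20:
  fixes M :: "('q::finite, 'a::finite) mealy"
  assumes "mealy_bireversible M"
    and "infinite (carrier (mealy_group M))"
    and "\<exists>g \<in> carrier (mealy_group M).
           \<forall>n::nat. n \<ge> 1 \<longrightarrow> g [^]\<^bsub>mealy_group M\<^esub> n \<noteq> \<one>\<^bsub>mealy_group M\<^esub>"
  shows "let
      stmt_i = (\<forall>\<xi> :: 'a word. torsion_group ((mealy_group M)\<lparr>carrier := Stab M \<xi>\<rparr>));
      stmt_ii = (positive_relations (dual_mealy M) = {} \<and>
        (\<forall>u :: 'q list. u \<noteq> [] \<longrightarrow>
           (Stab_pos (dual_mealy M) (u\<^sup>\<omega>) \<noteq> {\<one>\<^bsub>mealy_group (dual_mealy M)\<^esub>} \<longleftrightarrow>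
            (\<exists>l::nat. l \<ge> 1 \<and> state_prod M (concat (replicate l u)) = \<one>\<^bsub>mealy_group M\<^esub>))));
      stmt_iii = (\<forall>v :: 'q list. v \<noteq> [] \<longrightarrow>
        fin_digraph (orbital_graph (dual_mealy M) (v\<^sup>\<omega>)) \<or>
        acyclic_multidigraph (orbital_graph (dual_mealy M) (v\<^sup>\<omega>)))
    in (stmt_i \<longleftrightarrow> stmt_ii) \<and> (stmt_ii \<longleftrightarrow> stmt_iii)"
proof -
  have inv: "mealy_invertible M" and rev: "mealy_reversible M"
    using assms(1) by (simp_all add: mealy_bireversible_iff)
  obtain g where g: "g \<in> carrier (mealy_group M)" "\<not> finite_order g"
    using assms(3) by (auto simp: finite_order_def pow_mealy_group[OF inv])
  have torsion_iff: "(\<exists>l::nat. l \<ge> 1 \<and> state_prod M (concat (replicate l u)) = \<one>\<^bsub>mealy_group M\<^esub>)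
      \<longleftrightarrow> finite_order (state_prod M u)" for u
    by (simp add: finite_order_def state_prod_word_power)
  show ?thesis
    unfolding Let_def torsion_iff stabilizers_torsion_iff_commuting_torsion[OF inv rev]
      positive_stabilizers_iff_commuting_torsion[OF inv rev g]
      orbital_graphs_iff_commuting_torsion[OF assms(1)]
    by simp
qed

end
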